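(* Let $K_1,\dots,K_r\subset\mathbb{R}^n$ be closed convex sets and $K:=\bigcap_{l=1}^r K_l$. Suppose the SHQP algorithm (described in the context) with parameter $\bar p$ produces a sequence $\{x_i\}$ that converges to a point $\bar x\in K$, and that the convergence is not finite. Suppose also that if $\sum_{l=1}^r v_l=0$ for some $v_l\in N_{K_l}(\bar x)$, then $v_l=0$ for all $l=1,\dots,r$. This condition implies that $\{K_l\}_{l=1}^r$ satisfies the local metric inequality at $\bar x$ with some constant $\bar\kappa$. Let $\bar\alpha$ be such that $$\bar\alpha<\sin^{-1}(1/\bar\kappa),$$ and suppose that the parameter $\bar p$ is sufficiently large so that for any $\bar p$ unit vectors in $\mathbb{R}^n$, there are two vectors such that the angle between them is at most $\bar\alpha$. (a) For any $\epsilon>0$, there is an $I>0$ such that if $I<i<k$ and $\angle a_j^{(l)}0a_k^{(l_k^* )}\le\bar\alpha$ for some $(j,l)\in S_{k-1}$ with $j\ge i$, then $$\frac{\|x_k-\bar x\|}{\|x_i-\bar x\|}\le\frac{\|x_k-\bar x\|}{\|x_j-\bar x\|}\le\epsilon.$$ (b) Suppose in addition that all the sets $K_l$ have the SOSH property at $\bar x$. Then there are $M>0$ and $I>0$ such that if $I<i<k$ and $\angle a_j^{(l)}0a_k^{(l_k^* )}\le\bar\alpha$ for some $(j,l)\in S_{k-1}$ with $j\ge i$, then $$\frac{\|x_k-\bar x\|}{\|x_i-\bar x\|^2}\le\frac{\|x_k-\bar x\|}{\|x_j-\bar x\|^2}<M.$$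
   Context: Notation: $P_C$ is the Euclidean projection onto a closed convex set $C$; $N_C(x)=\{v\mid\langle v,y-x\rangle\le 0\ \forall y\in C\}$ is the normal cone at $x\in C$; $\mathbb{B}_\delta(x)$ is the closed ball of radius $\delta$ about $x$; $\mathrm{conv}$ is the convex hull; $\mathrm{pos}(S)=\{ts\mid t\ge 0,\ s\in S\}$; $d(x,S)$ is the distance from $x$ to $S$; $\angle u0v$ is the angle at the origin between nonzero vectors $u$ and $v$. SHQP algorithm for finding a point in $K=\bigcap_{l=1}^r K_l$. Given a starting point $x_0\in\mathbb{R}^n$ and a positive integer $\bar p$, for $i=0,1,2,\dots$: Step 1. For $l\in\{1,\dots,r\}$ set $x_i^{(l)}=P_{K_l}(x_i)$, $a_i^{(l)}=x_i-x_i^{(l)}$, $b_i^{(l)}=\langle a_i^{(l)},x_i^{(l)}\rangle$. Let $l_i^*\in\{1,\dots,r\}$ be an index attaining $\max_{1\le l\le r}\|x_i-P_{K_l}(x_i)\|$. Step 2. Choose $S_i\subset\{\max(i-\bar p,0),\dots,i\}\times\{1,\dots,r\}$ and define $\tilde F_i=\bigcap_{(j,l)\in S_i}H^{\le}_{(j,l)}$, where $H^{\le}_{(j,l)}=\{x:\langle a_j^{(l)},x\rangle\le b_j^{(l)}\}$. Choose $x_{i+1}$ such that (1) $x_{i+1}\in\tilde F_i$; (2) $\|x_{i+1}-c\|\le\|x_i-c\|$ for all $c\in K$; (3) $x_i-x_{i+1}\in\mathrm{pos}\big(\mathrm{conv}\{a_j^{(l)}:(j,l)\in S_i\}\big)$.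 "The convergence is not finite" means that $x_i\ne\bar x$ for all $i$. Local metric inequality: a collection of closed sets $K_l$, $l=1,\dots,r$, satisfies the local metric inequality at $\bar x$ with constant $\bar\kappa>0$ if there is $\delta>0$ such that $d(x,\bigcap_{l=1}^rK_l)\le\bar\kappa\max_{1\le l\le r}d(x,K_l)$ for all $x\in\mathbb{B}_\delta(\bar x)$. SOSH: a closed convex set $C\subset\mathbb{R}^n$ has the second order supporting hyperplane (SOSH) property at $\bar x\in C$ if there are $\delta>0$ and $M>0$ such that for any $x\in[\mathbb{B}_\delta(\bar x)\cap C]\setminus\{\bar x\}$ and any $v\in N_C(x)$ with $\|v\|=1$, we have $0\le-\langle v,\bar x-x\rangle\le M\|\bar x-x\|^2$. *)

theory Defs
  imports "HOL-Analysis.Analysis"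
begin

definition normal_cone :: "'a::real_inner set \<Rightarrow> 'a \<Rightarrow> 'a set" where
  "normal_cone C x = {v. \<forall>y\<in>C. v \<bullet> (y - x) \<le> 0}"

text \<open>No hull is taken here; in particular \<open>pos {} = {}\<close>.\<close>

definition pos :: "'a::real_vector set \<Rightarrow> 'a set" where
  "pos T = {t *\<^sub>R s | t s. 0 \<le> t \<and> s \<in> T}"

text \<open>The angle at the origin. It is meant for nonzero vectors; if one of them vanishes, the
  formula gives \<open>pi / 2\<close>.\<close>

definition vangle :: "'a::real_inner \<Rightarrow> 'a \<Rightarrow> real" where
  "vangle u v = arccos (u \<bullet> v / (norm u * norm v))"

text \<open>The collections \<open>K\<^sub>1, \<dots>, K\<^sub>r\<close> below are functions on \<open>nat\<close>; only the indices in \<open>{1..r}\<close> matter.\<close>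

definition local_metric_ineq :: "nat \<Rightarrow> (nat \<Rightarrow> 'a::euclidean_space set) \<Rightarrow> 'a \<Rightarrow> real \<Rightarrow> bool" where
  "local_metric_ineq r K xb \<kappa> \<longleftrightarrow> \<kappa> > 0 \<and>
     (\<exists>\<delta>>0. \<forall>x\<in>cball xb \<delta>.
        infdist x (\<Inter>l\<in>{1..r}. K l) \<le> \<kappa> * (MAX l\<in>{1..r}. infdist x (K l)))"

definition SOSH :: "'a::euclidean_space set \<Rightarrow> 'a \<Rightarrow> bool" where
  "SOSH C xb \<longleftrightarrow> (\<exists>\<delta>>0. \<exists>M>0. \<forall>x \<in> (cball xb \<delta> \<inter> C) - {xb}. \<forall>v \<in> normal_cone C x.
     norm v = 1 \<longrightarrow> 0 \<le> - (v \<bullet> (xb - x)) \<and> - (v \<bullet> (xb - x)) \<le> M * (norm (xb - x))\<^sup>2)"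

definition shqp_a :: "(nat \<Rightarrow> 'a::euclidean_space set) \<Rightarrow> (nat \<Rightarrow> 'a) \<Rightarrow> nat \<Rightarrow> nat \<Rightarrow> 'a" where
  "shqp_a K x i l = x i - closest_point (K l) (x i)"

definition shqp_b :: "(nat \<Rightarrow> 'a::euclidean_space set) \<Rightarrow> (nat \<Rightarrow> 'a) \<Rightarrow> nat \<Rightarrow> nat \<Rightarrow> real" where
  "shqp_b K x i l = shqp_a K x i l \<bullet> closest_point (K l) (x i)"

definition shqp_halfspace :: "(nat \<Rightarrow> 'a::euclidean_space set) \<Rightarrow> (nat \<Rightarrow> 'a) \<Rightarrow> nat \<Rightarrow> nat \<Rightarrow> 'a set" where
  "shqp_halfspace K x j l = {y. shqp_a K x j l \<bullet> y \<le> shqp_b K x j l}"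

text \<open>The iterates \<open>x\<close>, the index sets \<open>S\<close> and the maximizing indices \<open>lstar\<close> are a possible
  outcome of the SHQP algorithm with memory parameter \<open>p\<close>. Subtraction on \<open>nat\<close> truncates, so
  \<open>i - p\<close> is \<open>max (i - p) 0\<close>.\<close>

definition SHQP_run :: "nat \<Rightarrow> (nat \<Rightarrow> 'a::euclidean_space set) \<Rightarrow> nat \<Rightarrow> (nat \<Rightarrow> 'a)
    \<Rightarrow> (nat \<Rightarrow> (nat \<times> nat) set) \<Rightarrow> (nat \<Rightarrow> nat) \<Rightarrow> bool" where
  "SHQP_run r K p x S lstar \<longleftrightarrow> p > 0 \<and>
     (\<forall>i.
        lstar i \<in> {1..r} \<and>
        norm (x i - closest_point (K (lstar i)) (x i)) =
          (MAX l\<in>{1..r}. norm (x i - closest_point (K l) (x i))) \<and>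
        S i \<subseteq> {i - p..i} \<times> {1..r} \<and>
        x (Suc i) \<in> (\<Inter>(j, l)\<in>S i. shqp_halfspace K x j l) \<and>
        (\<forall>c \<in> (\<Inter>l\<in>{1..r}. K l). norm (x (Suc i) - c) \<le> norm (x i - c)) \<and>
        x i - x (Suc i) \<in> pos (convex hull {shqp_a K x j l | j l. (j, l) \<in> S i}))"

end

theory Submission
  imports Defs
begin

text \<open>The two estimates come from comparing the error vector \<open>x\<^sub>k - xb\<close> with a normal that
was computed earlier. Put \<open>t\<^sub>k = \<parallel>x\<^sub>k - xb\<parallel>\<close>, and let
\<open>v\<close> and \<open>u\<close> be the unit vectors along
\<open>a\<^sub>j\<^sup>(\<^sup>l\<^sup>)\<close> and along
\<open>a\<^sub>k\<^sup>(\<^sup>l\<^sup>*\<^sup>)\<close>, the largest residual at step \<open>k\<close>.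

Upper bound. The halfspace of \<open>(j, l)\<close> contains \<open>x\<^sub>k\<close>, and it is
supported at the projection \<open>y\<close> of \<open>x\<^sub>j\<close> onto \<open>K\<^sub>l\<close>;
so \<open>v \<bullet> (x\<^sub>k - xb) \<le> v \<bullet> (y - xb)\<close>. As \<open>v\<close> is a unit
normal at \<open>y\<close>, the right-hand side is always \<open>o(\<parallel>y - xb\<parallel>)\<close>,
and \<open>O(\<parallel>y - xb\<parallel>\<^sup>2)\<close> under SOSH, and \<open>\<parallel>y -
xb\<parallel> \<le> t\<^sub>j\<close> (\<open>cut_bound\<close>).

Lower bound. The iterates are Fejer monotone, so \<open>xb\<close> is at least as close to each \<open>c
\<in> K\<close> as \<open>x\<^sub>k\<close> is. Expanding squares, \<open>(x\<^sub>k - xb) \<bullet> (c -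
xb) \<le> t\<^sub>k\<^sup>2 / 2\<close>: the unit vector \<open>w\<close> along \<open>x\<^sub>k -
xb\<close> is asymptotically normal to \<open>K\<close> at \<open>xb\<close>, and hence
\<open>d(x\<^sub>k, K) / t\<^sub>k \<longlonglongrightarrow> 1\<close>
(\<open>asymptotically_at_full_distance\<close>). The metric inequality turns this into
\<open>\<parallel>a\<^sub>k\<^sup>(\<^sup>l\<^sup>*\<^sup>)\<parallel> \<ge> s t\<^sub>k\<close> for any
fixed \<open>s < 1 / \<kappa>\<close> and all late \<open>k\<close>. As \<open>xb\<close> lies behind the
hyperplane through the projection of \<open>x\<^sub>k\<close>, this gives \<open>u \<bullet> w \<ge>
s\<close>. An angle of at most \<open>\<alpha> < arcsin (1 / \<kappa>)\<close> between \<open>v\<close>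
and \<open>u\<close> leaves \<open>v \<bullet> w \<ge> c > 0\<close> with a constant \<open>c\<close>
(\<open>aligned_of_local_metric_ineq\<close>). Both bounds together give \<open>c t\<^sub>k \<le>
o(t\<^sub>j)\<close>, respectively \<open>c t\<^sub>k \<le> O(t\<^sub>j\<^sup>2)\<close>.

The metric inequality itself follows from the condition on the normals by a variational argument. For
\<open>f(y) = (\<Sum>\<^sub>l d(y, K\<^sub>l)\<^sup>2)\<^sup>1\<^sup>/\<^sup>2\<close>, the gradient of
\<open>f\<^sup>2 / 2\<close> is \<open>\<Sum>\<^sub>l (y - P\<^sub>l y)\<close>. By compactness, the
condition bounds the norm of this gradient below by \<open>\<eta> f\<close> near \<open>xb\<close>
(\<open>residual_sum_lower_bound\<close>), that is, \<open>f\<close> has slope at least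
\<open>\<eta>\<close> off \<open>K\<close>. A function with such a slope reaches \<open>0\<close> within
distance \<open>O(f / \<eta>)\<close>, since a minimizer of \<open>f\<close> plus a small multiple of the
distance to the given point has a small slope and must therefore lie in \<open>K\<close>
(\<open>metric_inequality_of_residual_sum_bound\<close>).\<close>

section \<open>Unit normals and the directions they see\<close>

text \<open>By compactness of the unit sphere, a unit vector whose inner products with all \<open>c - xb\<close> are
nearly nonpositive lies within \<open>\<epsilon>\<close> of an element of the normal cone at
\<open>xb\<close>. The absolute tolerance \<open>\<delta>\<close> thereby improves to one relative to
\<open>\<parallel>c - xb\<parallel>\<close>.\<close>

lemma approximately_normal:
  fixes C :: "'a::euclidean_space set"
  assumes "\<epsilon> > 0"
  obtains \<delta> where "\<delta> > 0"
    "\<And>w. norm w = 1 \<Longrightarrow> (\<And>c. c \<in> C \<Longrightarrow> w \<bullet> (c - xb) \<le> \<delta>)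
       \<Longrightarrow> (\<forall>c\<in>C. w \<bullet> (c - xb) \<le> \<epsilon> * norm (c - xb))"
proof (rule ccontr)
  assume neg: "\<not> thesis"
  have "\<exists>w. norm w = 1 \<and> (\<forall>c\<in>C. w \<bullet> (c - xb) \<le> inverse (real (Suc n)))
          \<and> (\<exists>c\<in>C. w \<bullet> (c - xb) > \<epsilon> * norm (c - xb))" for n
    using neg that[of "inverse (real (Suc n))"] by (force simp: not_le)
  then obtain w where w1: "\<And>n. norm (w n) = 1"
    and wle: "\<And>n c. c \<in> C \<Longrightarrow> w n \<bullet> (c - xb) \<le> inverse (real (Suc n))"
    and wgt: "\<And>n. \<exists>c\<in>C. w n \<bullet> (c - xb) > \<epsilon> * norm (c - xb)"
    by metis
  have "\<forall>n. w n \<in> sphere 0 1" using w1 by simp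
  then obtain w' \<phi> where "strict_mono (\<phi>::nat\<Rightarrow>nat)" and lim: "(w \<circ> \<phi>) \<longlonglongrightarrow> w'"
    using compact_sphere[of "0::'a" 1] unfolding compact_def by metis
  \<comment> \<open>The limit is an exact normal; an index where \<open>w\<close> is within \<open>\<epsilon>\<close> of it gives the contradiction.\<close>
  have normal: "w' \<bullet> (c - xb) \<le> 0" if "c \<in> C" for c
  proof (rule LIMSEQ_le)
    show "(\<lambda>n. (w \<circ> \<phi>) n \<bullet> (c - xb)) \<longlonglongrightarrow> w' \<bullet> (c - xb)"
      using lim by (intro tendsto_intros)
    show "(\<lambda>n. inverse (real (Suc (\<phi> n)))) \<longlonglongrightarrow> 0"
      using LIMSEQ_subseq_LIMSEQ[OF LIMSEQ_inverse_real_of_nat \<open>strict_mono \<phi>\<close>]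
      by (simp add: o_def)
    show "\<exists>N. \<forall>n\<ge>N. (w \<circ> \<phi>) n \<bullet> (c - xb) \<le> inverse (real (Suc (\<phi> n)))"
      using wle[OF that] by auto
  qed
  obtain n where n: "norm ((w \<circ> \<phi>) n - w') < \<epsilon>"
    using LIMSEQ_D[OF lim assms] by blast
  obtain c where c: "c \<in> C" "w (\<phi> n) \<bullet> (c - xb) > \<epsilon> * norm (c - xb)"
    using wgt by blast
  have "w (\<phi> n) \<bullet> (c - xb) = w' \<bullet> (c - xb) + (w (\<phi> n) - w') \<bullet> (c - xb)"
    by (simp add: inner_diff_left)
  also have "\<dots> \<le> 0 + norm (w (\<phi> n) - w') * norm (c - xb)"
    using normal[OF c(1)] norm_cauchy_schwarz by (intro add_mono) auto
  also have "\<dots> \<le> \<epsilon> * norm (c - xb)"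
    using n by (simp add: mult_right_mono)
  finally show False using c(2) by simp
qed

text \<open>A unit normal \<open>v\<close> at \<open>y \<in> C\<close> satisfies \<open>v \<bullet> (y - xb) \<ge>
0\<close> for \<open>xb \<in> C\<close>, and this number is the distance of \<open>xb\<close> from the
supporting hyperplane at \<open>y\<close>. The bound \<open>\<rho>\<close> on it is the only thing that
differs between the superlinear and the quadratic estimate.\<close>

definition normal_defect_bound :: "'a::real_inner set \<Rightarrow> 'a \<Rightarrow> (real \<Rightarrow> real) \<Rightarrow> bool" where
  "normal_defect_bound C xb \<rho> \<longleftrightarrow> (\<forall>\<^sub>F y in nhds xb. y \<in> C \<longrightarrow>
    (\<forall>v\<in>normal_cone C y. norm v = 1 \<longrightarrow> v \<bullet> (y - xb) \<le> \<rho> (norm (y - xb))))"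

lemma normal_defect_bound_mono:
  assumes "normal_defect_bound C xb \<rho>" "\<And>t. \<rho> t \<le> \<sigma> t"
  shows "normal_defect_bound C xb \<sigma>"
  using assms(1) unfolding normal_defect_bound_def
  by (rule eventually_mono) (meson assms(2) order_trans)

text \<open>A unit normal \<open>v\<close> at \<open>y\<close> satisfies \<open>v \<bullet> (c - xb) \<le> v
\<bullet> (y - xb) \<le> \<parallel>y - xb\<parallel>\<close> for all \<open>c \<in> C\<close>, so it is
almost normal at \<open>xb\<close> when \<open>y\<close> is near; \<open>approximately_normal\<close> is
then applied with \<open>c = y\<close>.\<close>

lemma normal_defect_bound_linear:
  fixes C :: "'a::euclidean_space set"
  assumes "\<epsilon> > 0"
  shows "normal_defect_bound C xb (\<lambda>t. \<epsilon> * t)"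
proof -
  obtain \<delta> where \<delta>: "\<delta> > 0"
    "\<And>w. norm w = 1 \<Longrightarrow> (\<And>c. c \<in> C \<Longrightarrow> w \<bullet> (c - xb) \<le> \<delta>)
       \<Longrightarrow> (\<forall>c\<in>C. w \<bullet> (c - xb) \<le> \<epsilon> * norm (c - xb))"
    using approximately_normal[OF assms] by blast
  show ?thesis
  proof (unfold normal_defect_bound_def eventually_nhds_metric, intro exI conjI allI impI ballI)
    fix y v assume y: "dist y xb < \<delta>" "y \<in> C" and v: "v \<in> normal_cone C y" "norm v = 1"
    have "v \<bullet> (c - xb) \<le> \<delta>" if "c \<in> C" for c
    proof -
      have "v \<bullet> (c - xb) = v \<bullet> (c - y) + v \<bullet> (y - xb)" by (simp add: inner_diff_right)
      also have "\<dots> \<le> 0 + norm v * norm (y - xb)"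
        using v(1) that norm_cauchy_schwarz by (intro add_mono) (auto simp: normal_cone_def)
      finally show ?thesis using y(1) v(2) by (simp add: dist_norm)
    qed
    then show "v \<bullet> (y - xb) \<le> \<epsilon> * norm (y - xb)" using \<delta>(2) v(2) y(2) by blast
  qed (rule \<delta>(1))
qed

text \<open>The SOSH property excludes the base point, where both sides vanish.\<close>

lemma normal_defect_bound_quadratic:
  fixes C :: "'a::euclidean_space set"
  assumes "SOSH C xb"
  shows "\<exists>M. normal_defect_bound C xb (\<lambda>t. M * t\<^sup>2)"
proof -
  obtain \<delta> M where *: "\<delta> > 0" "\<forall>x \<in> (cball xb \<delta> \<inter> C) - {xb}. \<forall>v \<in> normal_cone C x.
     norm v = 1 \<longrightarrow> 0 \<le> - (v \<bullet> (xb - x)) \<and> - (v \<bullet> (xb - x)) \<le> M * (norm (xb - x))\<^sup>2"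
    using assms unfolding SOSH_def by blast
  show ?thesis
  proof (unfold normal_defect_bound_def eventually_nhds_metric, intro exI conjI allI impI ballI)
    fix y v assume y: "dist y xb < \<delta>" "y \<in> C" and v: "v \<in> normal_cone C y" "norm v = 1"
    show "v \<bullet> (y - xb) \<le> M * (norm (y - xb))\<^sup>2"
    proof (cases "y = xb")
      case False
      then have "- (v \<bullet> (xb - y)) \<le> M * (norm (xb - y))\<^sup>2"
        using * y v by (auto simp: dist_commute)
      then show ?thesis by (simp add: inner_diff_right norm_minus_commute)
    qed simp
  qed (rule *(1))
qed

lemma closest_point_residual_normal:
  fixes C :: "'a::euclidean_space set"
  assumes "closed C" "convex C"
  shows "y - closest_point C y \<in> normal_cone C (closest_point C y)"
  using closest_point_dot[OF assms(2,1)] by (auto simp: normal_cone_def)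

lemma norm_residual_eq_infdist:
  fixes C :: "'a::euclidean_space set"
  assumes "closed C" "C \<noteq> {}"
  shows "norm (y - closest_point C y) = infdist y C"
  using setdist_closest_point[OF assms, of y] by (simp add: infdist_eq_setdist dist_norm)

lemma scaleR_mem_normal_cone:
  "v \<in> normal_cone C y \<Longrightarrow> 0 \<le> s \<Longrightarrow> s *\<^sub>R v \<in> normal_cone C y"
  by (auto simp: normal_cone_def mult_nonneg_nonpos)

section \<open>Angles\<close>

text \<open>The triangle inequality for angles, in the form needed here: if \<open>v\<close> is within
\<open>\<alpha>\<close> of \<open>u\<close>, and \<open>w\<close> is within \<open>pi / 2 -
\<theta>\<close> of \<open>u\<close>, then \<open>w\<close> is within \<open>pi / 2 - (\<theta> -
\<alpha>)\<close> of \<open>v\<close>. The components of \<open>v\<close> and \<open>w\<close> orthogonal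
to \<open>u\<close> have norms at most \<open>sin \<alpha>\<close> and \<open>cos \<theta>\<close>.\<close>

lemma inner_ge_sin_diff:
  fixes u v w :: "'a::real_inner"
  assumes "norm u = 1" "norm v = 1" "norm w = 1"
    and \<alpha>: "0 \<le> \<alpha>" "\<alpha> \<le> \<theta>" "\<theta> \<le> pi / 2"
    and vu: "cos \<alpha> \<le> v \<bullet> u" and uw: "sin \<theta> \<le> u \<bullet> w"
  shows "sin (\<theta> - \<alpha>) \<le> v \<bullet> w"
proof -
  define v' where "v' = v - (v \<bullet> u) *\<^sub>R u"
  define w' where "w' = w - (u \<bullet> w) *\<^sub>R u"
  have uu: "u \<bullet> u = 1" "v \<bullet> v = 1" "w \<bullet> w = 1" using assms by (simp_all add: dot_square_norm)
  have pos: "0 \<le> cos \<alpha>" "0 \<le> sin \<theta>" "0 \<le> cos \<theta>" "0 \<le> sin \<alpha>"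
    using \<alpha> by (auto intro!: cos_ge_zero sin_ge_zero)
  have "v' \<bullet> v' = 1 - (v \<bullet> u)\<^sup>2"
    by (simp add: v'_def inner_diff_left inner_diff_right uu power2_eq_square inner_commute)
  also have "\<dots> \<le> (sin \<alpha>)\<^sup>2"
    using power_mono[OF vu pos(1), of 2] sin_cos_squared_add[of \<alpha>] by linarith
  finally have v': "norm v' \<le> sin \<alpha>"
    using pos by (simp add: dot_square_norm power2_le_iff_abs_le)
  have "w' \<bullet> w' = 1 - (u \<bullet> w)\<^sup>2"
    by (simp add: w'_def inner_diff_left inner_diff_right uu power2_eq_square inner_commute)
  also have "\<dots> \<le> (cos \<theta>)\<^sup>2"
    using power_mono[OF uw pos(2), of 2] sin_cos_squared_add[of \<theta>] by linarith
  finally have w': "norm w' \<le> cos \<theta>"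
    using pos by (simp add: dot_square_norm power2_le_iff_abs_le)
  have "sin (\<theta> - \<alpha>) = cos \<alpha> * sin \<theta> - sin \<alpha> * cos \<theta>"
    by (simp add: sin_diff)
  also have "\<dots> \<le> (v \<bullet> u) * (u \<bullet> w) - norm v' * norm w'"
    using pos vu uw v' w' by (intro diff_mono mult_mono) auto
  also have "\<dots> \<le> (v \<bullet> u) * (u \<bullet> w) + v' \<bullet> w'"
    using Cauchy_Schwarz_ineq2[of v' w'] by linarith
  also have "\<dots> = v \<bullet> w"
    by (simp add: v'_def w'_def inner_diff_left inner_diff_right uu inner_commute)
  finally show ?thesis .
qed

text \<open>The convention that the angle with the zero vector is \<open>pi / 2\<close> makes an angle below
\<open>pi / 2\<close> a certificate that both vectors are nonzero.\<close>

lemma vangle_le_imp: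
  fixes a b :: "'a::real_inner"
  assumes "vangle a b \<le> \<alpha>" "\<alpha> < pi / 2"
  shows "a \<noteq> 0" "b \<noteq> 0" "0 \<le> \<alpha>" "cos \<alpha> \<le> sgn a \<bullet> sgn b"
proof -
  have ne: "\<not> pi / 2 \<le> \<alpha>" using assms by simp
  then show "a \<noteq> 0" "b \<noteq> 0" using assms(1) by (auto simp: vangle_def)
  have eq: "a \<bullet> b / (norm a * norm b) = sgn a \<bullet> sgn b"
    by (simp add: sgn_div_norm divide_inverse)
  have "\<bar>sgn a \<bullet> sgn b\<bar> \<le> 1"
    using Cauchy_Schwarz_ineq2[of "sgn a" "sgn b"] \<open>a \<noteq> 0\<close> \<open>b \<noteq> 0\<close> by (simp add: norm_sgn)
  then have *: "-1 \<le> sgn a \<bullet> sgn b" "sgn a \<bullet> sgn b \<le> 1" by auto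
  have ge: "0 \<le> vangle a b" unfolding vangle_def eq using * by (rule arccos_lbound)
  then show "0 \<le> \<alpha>" using assms by simp
  have "cos \<alpha> \<le> cos (vangle a b)"
    using assms ge by (intro cos_monotone_0_pi_le) auto
  also have "\<dots> = sgn a \<bullet> sgn b" unfolding vangle_def eq using * by (simp add: cos_arccos)
  finally show "cos \<alpha> \<le> sgn a \<bullet> sgn b" .
qed

section \<open>Distance to the set versus distance to the limit\<close>

text \<open>That \<open>xb\<close> is closer than \<open>x k\<close> to every point of \<open>C\<close> makes the
unit vector \<open>w\<close> along \<open>x k - xb\<close> almost normal to \<open>C\<close> at
\<open>xb\<close>. So the projection of \<open>x k\<close> onto \<open>C\<close> can gain next to nothing
over \<open>xb\<close> in the direction \<open>w\<close>.\<close>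

lemma asymptotically_at_full_distance:
  fixes C :: "'a::euclidean_space set" and x :: "nat \<Rightarrow> 'a"
  assumes "closed C" "xb \<in> C" and lim: "x \<longlonglongrightarrow> xb" and "\<epsilon> > 0"
    and ne: "\<And>k. x k \<noteq> xb"
    and closer: "\<And>k c. c \<in> C \<Longrightarrow> norm (xb - c) \<le> norm (x k - c)"
  shows "\<forall>\<^sub>F k in sequentially. (1 - \<epsilon>) * norm (x k - xb) \<le> infdist (x k) C"
proof -
  obtain \<delta> where \<delta>: "\<delta> > 0"
    "\<And>w. norm w = 1 \<Longrightarrow> (\<And>c. c \<in> C \<Longrightarrow> w \<bullet> (c - xb) \<le> \<delta>)
       \<Longrightarrow> (\<forall>c\<in>C. w \<bullet> (c - xb) \<le> \<epsilon> / 2 * norm (c - xb))"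
    using approximately_normal[of "\<epsilon> / 2" C xb] \<open>\<epsilon> > 0\<close> by auto
  have "\<forall>\<^sub>F k in sequentially. dist (x k) xb < \<delta>" using lim \<delta>(1) by (rule tendstoD)
  then show ?thesis
  proof eventually_elim
    case (elim k)
    define t where "t = norm (x k - xb)"
    define w where "w = sgn (x k - xb)"
    have t: "t > 0" "t < \<delta>" using ne elim by (auto simp: t_def dist_norm)
    have w: "norm w = 1" "x k - xb = t *\<^sub>R w"
      using ne by (auto simp: w_def t_def norm_sgn sgn_div_norm)
    have ww: "w \<bullet> w = 1" using w(1) by (simp add: dot_square_norm)
    have "w \<bullet> (c - xb) \<le> \<delta>" if "c \<in> C" for c
    proof -
      have eq: "x k - c = t *\<^sub>R w + (xb - c)" using w(2) by (simp add: algebra_simps)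
      have "(norm (xb - c))\<^sup>2 \<le> (norm (x k - c))\<^sup>2"
        using closer[OF that] by (simp add: power_mono)
      also have "\<dots> = t\<^sup>2 + 2 * t * (w \<bullet> (xb - c)) + (norm (xb - c))\<^sup>2"
        unfolding eq power2_norm_eq_inner
        by (simp add: ww inner_add_left inner_add_right power2_eq_square inner_commute)
      finally have "0 \<le> t * (t - 2 * (w \<bullet> (c - xb)))"
        by (simp add: inner_diff_right algebra_simps power2_eq_square)
      then have "0 \<le> t - 2 * (w \<bullet> (c - xb))" using t(1) by (simp add: zero_le_mult_iff)
      then show ?thesis using t by linarith
    qed
    then have near: "\<forall>c\<in>C. w \<bullet> (c - xb) \<le> \<epsilon> / 2 * norm (c - xb)" using \<delta>(2) w(1) by blast
    define c where "c = closest_point C (x k)"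
    have c: "c \<in> C" "norm (x k - c) \<le> t"
      using assms closest_point_in_set[of C] closest_point_le[of C xb "x k"]
      by (auto simp: c_def t_def dist_norm)
    have "norm (c - xb) \<le> 2 * t"
      using norm_triangle_ineq4[of "x k - xb" "x k - c"] c(2) by (simp add: t_def)
    then have "\<epsilon> / 2 * norm (c - xb) \<le> \<epsilon> / 2 * (2 * t)"
      using \<open>\<epsilon> > 0\<close> by (intro mult_left_mono) auto
    with bspec[OF near c(1)] have "w \<bullet> (c - xb) \<le> \<epsilon> * t" by simp
    then have "(1 - \<epsilon>) * t \<le> w \<bullet> (t *\<^sub>R w) - w \<bullet> (c - xb)"
      using w(1) by (simp add: dot_square_norm algebra_simps)
    also have "\<dots> = w \<bullet> (x k - c)" unfolding w(2)[symmetric] by (simp add: inner_diff_right)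
    also have "\<dots> \<le> norm (x k - c)" using norm_cauchy_schwarz[of w "x k - c"] w(1) by simp
    also have "\<dots> = infdist (x k) C"
      using assms(1,2) by (auto simp: c_def intro: norm_residual_eq_infdist)
    finally show ?case by (simp add: t_def)
  qed
qed

section \<open>From independent normals to the local metric inequality\<close>

lemma bounded_family_convergent_subsequence:
  fixes v :: "nat \<Rightarrow> 'i \<Rightarrow> 'a::euclidean_space"
  assumes "finite L" "\<And>n l. l \<in> L \<Longrightarrow> norm (v n l) \<le> B"
  shows "\<exists>\<phi> V. strict_mono \<phi> \<and> (\<forall>l\<in>L. (\<lambda>n. v (\<phi> n) l) \<longlonglongrightarrow> V l)"
  using assms
proof (induction L rule: finite_induct)
  case empty
  show ?case using strict_mono_id by auto
next
  case (insert l0 L)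
  then obtain \<phi> V where \<phi>: "strict_mono (\<phi> :: nat \<Rightarrow> nat)"
    and V: "\<forall>l\<in>L. (\<lambda>n. v (\<phi> n) l) \<longlonglongrightarrow> V l"
    by auto
  have "\<forall>n. v (\<phi> n) l0 \<in> cball 0 B" using insert.prems by simp
  then obtain a \<psi> where \<psi>: "strict_mono (\<psi> :: nat \<Rightarrow> nat)" "((\<lambda>n. v (\<phi> n) l0) \<circ> \<psi>) \<longlonglongrightarrow> a"
    using compact_cball[of "0::'a" B] unfolding compact_def by metis
  have "(\<lambda>n. v ((\<phi> \<circ> \<psi>) n) l) \<longlonglongrightarrow> (V(l0 := a)) l" if "l \<in> insert l0 L" for l
  proof (cases "l = l0")
    case False
    then have "(\<lambda>n. v (\<phi> n) l) \<longlonglongrightarrow> V l" using V that by blast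
    from LIMSEQ_subseq_LIMSEQ[OF this \<psi>(1)] show ?thesis using False by (simp add: o_def)
  qed (use \<psi>(2) in \<open>simp add: o_def\<close>)
  then show ?case using strict_mono_o[OF \<phi> \<psi>(1)] by blast
qed

text \<open>For closed convex sets, the square of \<open>residual_norm\<close> has gradient twice
\<open>residual_sum\<close>. Both are defined by closest points, without the distance, so that they speak
about the same vectors \<open>y - P\<^sub>l y\<close>.\<close>

definition residual_norm :: "('i \<Rightarrow> 'a::euclidean_space set) \<Rightarrow> 'i set \<Rightarrow> 'a \<Rightarrow> real" where
  "residual_norm K L y = L2_set (\<lambda>l. norm (y - closest_point (K l) y)) L"

definition residual_sum :: "('i \<Rightarrow> 'a::euclidean_space set) \<Rightarrow> 'i set \<Rightarrow> 'a \<Rightarrow> 'a" where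
  "residual_sum K L y = (\<Sum>l\<in>L. y - closest_point (K l) y)"

text \<open>The residuals \<open>y - P\<^sub>l y\<close> are normals at the projections. If the bound failed at
points tending to \<open>xb\<close>, then the residuals, scaled to have total square norm
\<open>1\<close>, would have a limit in the normal cones at \<open>xb\<close> with sum zero and still of
total square norm \<open>1\<close>. One number \<open>\<eta>\<close> serves as radius and as slope.\<close>

lemma residual_sum_lower_bound:
  fixes K :: "'i \<Rightarrow> 'a::euclidean_space set"
  assumes "finite L" and cc: "\<And>l. l \<in> L \<Longrightarrow> closed (K l) \<and> convex (K l)"
    and xb: "xb \<in> (\<Inter>l\<in>L. K l)"
    and normals: "\<And>v. (\<And>l. l \<in> L \<Longrightarrow> v l \<in> normal_cone (K l) xb) \<Longrightarrow> (\<Sum>l\<in>L. v l) = 0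
          \<Longrightarrow> (\<forall>l\<in>L. v l = 0)"
  shows "\<exists>\<eta>>0. \<forall>y\<in>cball xb \<eta>. \<eta> * residual_norm K L y \<le> norm (residual_sum K L y)"
proof (rule ccontr)
  assume neg: "\<not> ?thesis"
  define e where "e n = inverse (real (Suc n))" for n
  have "\<forall>n. \<exists>y. y \<in> cball xb (e n) \<and> norm (residual_sum K L y) < e n * residual_norm K L y"
  proof
    fix n
    have "e n > 0" by (simp add: e_def)
    with neg show "\<exists>y. y \<in> cball xb (e n) \<and> norm (residual_sum K L y) < e n * residual_norm K L y"
      by (meson not_le)
  qed
  then obtain y where y: "\<And>n. y n \<in> cball xb (e n)"
    "\<And>n. norm (residual_sum K L (y n)) < e n * residual_norm K L (y n)"
    by metis
  have e0: "e \<longlonglongrightarrow> 0" unfolding e_def by (rule LIMSEQ_inverse_real_of_nat)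
  have fpos: "residual_norm K L (y n) > 0" for n
  proof (rule zero_less_mult_pos)
    show "0 < e n * residual_norm K L (y n)" using y(2) by (rule le_less_trans[OF norm_ge_zero])
  qed (simp add: e_def)
  define q where "q n l = closest_point (K l) (y n)" for n l
  define v where "v n l = (1 / residual_norm K L (y n)) *\<^sub>R (y n - q n l)" for n l
  have sq1: "(\<Sum>l\<in>L. (norm (v n l))\<^sup>2) = 1" for n
  proof -
    have "(\<Sum>l\<in>L. (norm (v n l))\<^sup>2)
        = (\<Sum>l\<in>L. (norm (y n - q n l))\<^sup>2) / (residual_norm K L (y n))\<^sup>2"
      by (simp add: v_def power_divide sum_divide_distrib fpos)
    also have "(residual_norm K L (y n))\<^sup>2 = (\<Sum>l\<in>L. (norm (y n - q n l))\<^sup>2)"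
      by (simp add: residual_norm_def L2_set_def q_def sum_nonneg)
    finally show ?thesis using fpos[of n] by (auto simp: residual_norm_def L2_set_def q_def)
  qed
  have "norm (v n l) \<le> 1" if "l \<in> L" for n l
  proof -
    have "(norm (v n l))\<^sup>2 \<le> (\<Sum>l\<in>L. (norm (v n l))\<^sup>2)"
      using that \<open>finite L\<close> by (intro member_le_sum) auto
    then show ?thesis unfolding sq1 by (simp add: abs_square_le_1)
  qed
  then obtain \<phi> V where \<phi>: "strict_mono (\<phi> :: nat \<Rightarrow> nat)"
    and V: "\<And>l. l \<in> L \<Longrightarrow> (\<lambda>n. v (\<phi> n) l) \<longlonglongrightarrow> V l"
    using bounded_family_convergent_subsequence[OF \<open>finite L\<close>] by metis
  have e\<phi>: "(\<lambda>n. e (\<phi> n)) \<longlonglongrightarrow> 0" using LIMSEQ_subseq_LIMSEQ[OF e0 \<phi>] by (simp add: o_def)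
  have "V l \<in> normal_cone (K l) xb" if l: "l \<in> L" for l
    unfolding normal_cone_def
  proof (intro CollectI ballI)
    fix c assume c: "c \<in> K l"
    have "norm (q n l - xb) \<le> e n" for n
      using closest_point_lipschitz[of "K l" "y n" xb] cc[OF l] xb l y(1)[of n]
      by (fastforce simp: q_def dist_norm closest_point_self norm_minus_commute)
    then have "(\<lambda>n. q (\<phi> n) l - xb) \<longlonglongrightarrow> 0"
      by (intro Lim_null_comparison[OF _ e\<phi>]) auto
    then have "(\<lambda>n. q (\<phi> n) l) \<longlonglongrightarrow> xb" by (simp add: LIM_zero_iff)
    then have "(\<lambda>n. v (\<phi> n) l \<bullet> (c - q (\<phi> n) l)) \<longlonglongrightarrow> V l \<bullet> (c - xb)"
      using V[OF l] by (intro tendsto_intros)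
    moreover have "v n l \<bullet> (c - q n l) \<le> 0" for n
      using closest_point_dot[of "K l" c "y n"] cc[OF l] c fpos[of n]
      by (simp add: v_def q_def mult_nonneg_nonpos divide_nonpos_pos)
    ultimately show "V l \<bullet> (c - xb) \<le> 0" by (intro LIMSEQ_le_const2) auto
  qed
  moreover have "(\<Sum>l\<in>L. V l) = 0"
  proof (rule LIMSEQ_unique)
    show "(\<lambda>n. \<Sum>l\<in>L. v (\<phi> n) l) \<longlonglongrightarrow> (\<Sum>l\<in>L. V l)" using V by (rule tendsto_sum)
    have "norm (\<Sum>l\<in>L. v n l) \<le> e n" for n
    proof -
      have "(\<Sum>l\<in>L. v n l) = (1 / residual_norm K L (y n)) *\<^sub>R residual_sum K L (y n)"
        by (simp add: v_def residual_sum_def q_def scaleR_right.sum)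
      then show ?thesis using y(2)[of n] fpos[of n] by (simp add: field_simps)
    qed
    then show "(\<lambda>n. \<Sum>l\<in>L. v (\<phi> n) l) \<longlonglongrightarrow> 0"
      by (intro Lim_null_comparison[OF _ e\<phi>]) auto
  qed
  ultimately have "\<forall>l\<in>L. V l = 0" by (rule normals)
  moreover have "(\<lambda>n. \<Sum>l\<in>L. (norm (v (\<phi> n) l))\<^sup>2) \<longlonglongrightarrow> (\<Sum>l\<in>L. (norm (V l))\<^sup>2)"
    using V by (intro tendsto_intros)
  ultimately have "(\<lambda>n::nat. 1::real) \<longlonglongrightarrow> 0" by (simp add: sq1)
  then show False by (simp add: LIMSEQ_const_iff)
qed

text \<open>Keeping the old projections while moving by \<open>h\<close> can only overestimate the new distances;
this yields the quadratic upper model of the squared residual norm without any differentiation.\<close>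

lemma residual_norm_descent:
  fixes K :: "'i \<Rightarrow> 'a::euclidean_space set"
  assumes "finite L" and cc: "\<And>l. l \<in> L \<Longrightarrow> closed (K l) \<and> K l \<noteq> {}"
  shows "(residual_norm K L (y + h))\<^sup>2
    \<le> (residual_norm K L y)\<^sup>2 + 2 * (residual_sum K L y \<bullet> h) + real (card L) * (norm h)\<^sup>2"
proof -
  define q where "q l = closest_point (K l) y" for l
  have sq: "(residual_norm K L z)\<^sup>2 = (\<Sum>l\<in>L. (norm (z - closest_point (K l) z))\<^sup>2)" for z
    by (simp add: residual_norm_def L2_set_def sum_nonneg)
  have "(residual_norm K L (y + h))\<^sup>2 \<le> (\<Sum>l\<in>L. (norm ((y - q l) + h))\<^sup>2)"
    unfolding sq
  proof (intro sum_mono power_mono norm_ge_zero)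
    fix l assume "l \<in> L"
    then show "norm (y + h - closest_point (K l) (y + h)) \<le> norm ((y - q l) + h)"
      using closest_point_le[of "K l" "q l" "y + h"] cc closest_point_in_set[of "K l" y]
      by (simp add: q_def dist_norm algebra_simps)
  qed
  also have "\<dots> = (\<Sum>l\<in>L. (norm (y - q l))\<^sup>2 + 2 * ((y - q l) \<bullet> h) + (norm h)\<^sup>2)"
    unfolding power2_norm_eq_inner by (simp add: inner_add_left inner_add_right inner_commute add_ac)
  also have "\<dots> = (residual_norm K L y)\<^sup>2 + 2 * (residual_sum K L y \<bullet> h) + real (card L) * (norm h)\<^sup>2"
    unfolding sq residual_sum_def q_def
    by (simp add: sum.distrib inner_sum_left sum_distrib_left)
  finally show ?thesis .
qed

text \<open>A step from \<open>y\<close> against the gradient direction \<open>A\<close> lowers the residual norm to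
first order at the rate \<open>\<parallel>A\<parallel>\<^sup>2 / f\<close> per unit of the step
parameter, whereas the penalty grows at the rate \<open>\<mu> \<parallel>A\<parallel>\<close>. A
minimizer has therefore \<open>\<parallel>A\<parallel> \<le> \<mu> f\<close>; the factor \<open>2\<close>
pays for a step of positive length.\<close>

lemma small_residual_sum_at_penalized_minimizer:
  fixes K :: "'i \<Rightarrow> 'a::euclidean_space set"
  assumes "finite L" and cc: "\<And>l. l \<in> L \<Longrightarrow> closed (K l) \<and> K l \<noteq> {}"
    and "\<mu> > 0" and pos: "residual_norm K L y > 0"
    and min: "\<And>z. residual_norm K L y \<le> residual_norm K L z + \<mu> * norm (z - y)"
  shows "norm (residual_sum K L y) \<le> 2 * \<mu> * residual_norm K L y"
proof (cases "residual_sum K L y = 0")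
  case True
  then show ?thesis using \<open>\<mu> > 0\<close> pos by simp
next
  case False
  define A where "A = residual_sum K L y"
  define a where "a = norm A"
  define f where "f = residual_norm K L y"
  define N where "N = real (card L)"
  have "L \<noteq> {}" using pos by (auto simp: residual_norm_def)
  then have N: "N > 0" using \<open>finite L\<close> by (simp add: N_def card_gt_0_iff)
  have a: "a > 0" using False by (simp add: a_def A_def)
  \<comment> \<open>The first bound tames the quadratic term of the model; the second keeps the left-hand side of the
    inequality nonnegative, so that it may be squared.\<close>
  define s where "s = min (1 / N) (f / (\<mu> * a))"
  have s: "s > 0" "N * s \<le> 1" "\<mu> * (s * a) \<le> f"
  proof -
    show "s > 0" using N a \<open>\<mu> > 0\<close> pos by (simp add: s_def f_def)
    have "s \<le> 1 / N" "s \<le> f / (\<mu> * a)" by (simp_all add: s_def)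
    then show "N * s \<le> 1" "\<mu> * (s * a) \<le> f" using N a \<open>\<mu> > 0\<close> by (simp_all add: field_simps)
  qed
  have "f - \<mu> * (s * a) \<le> residual_norm K L (y + - s *\<^sub>R A)"
    using min[of "y + - s *\<^sub>R A"] s(1) by (simp add: f_def a_def)
  then have "(f - \<mu> * (s * a))\<^sup>2 \<le> (residual_norm K L (y + - s *\<^sub>R A))\<^sup>2"
    using s(3) by (intro power_mono) auto
  also have "\<dots> \<le> f\<^sup>2 + 2 * (A \<bullet> (- s *\<^sub>R A)) + N * (norm (- s *\<^sub>R A))\<^sup>2"
    using residual_norm_descent[OF assms(1), of K, OF cc] unfolding f_def A_def N_def by blast
  also have "\<dots> = f\<^sup>2 - 2 * s * a\<^sup>2 + (N * s) * s * a\<^sup>2"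
    by (simp add: a_def power_mult_distrib dot_square_norm power2_eq_square)
  also have "\<dots> \<le> f\<^sup>2 - 2 * s * a\<^sup>2 + 1 * s * a\<^sup>2"
    using s by (intro add_left_mono mult_right_mono) auto
  finally have "s * a * a \<le> s * a * (2 * \<mu> * f)"
    using zero_le_power2[of "\<mu> * (s * a)"] by (simp add: power2_eq_square algebra_simps)
  then have "a \<le> 2 * \<mu> * f" using s(1) a by simp
  then show ?thesis by (simp add: a_def A_def f_def)
qed

lemma continuous_on_residual_norm:
  fixes K :: "'i \<Rightarrow> 'a::euclidean_space set"
  assumes "\<And>l. l \<in> L \<Longrightarrow> closed (K l) \<and> K l \<noteq> {}"
  shows "continuous_on T (residual_norm K L)"
proof -
  have "residual_norm K L = (\<lambda>y. sqrt (\<Sum>l\<in>L. (infdist y (K l))\<^sup>2))"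
    using assms by (simp add: fun_eq_iff residual_norm_def L2_set_def norm_residual_eq_infdist)
  then show ?thesis by (simp add: continuous_intros)
qed

text \<open>A minimizer of \<open>f + \<eta>/4 \<parallel>\<cdot> - x\<parallel>\<close> is no further than \<open>4
f(x) / \<eta>\<close> from \<open>x\<close>. Were this less than the distance to the intersection, then
the minimizer would lie outside of it, still within \<open>\<eta>\<close> of \<open>xb\<close>, and with
a slope of at most \<open>\<eta> / 2\<close>, below the assumed lower bound.\<close>

lemma metric_inequality_of_residual_sum_bound:
  fixes K :: "'i \<Rightarrow> 'a::euclidean_space set"
  assumes "finite L" and cc: "\<And>l. l \<in> L \<Longrightarrow> closed (K l)"
    and xb: "xb \<in> (\<Inter>l\<in>L. K l)" and "\<eta> > 0"
    and lower: "\<And>y. y \<in> cball xb \<eta> \<Longrightarrow> \<eta> * residual_norm K L y \<le> norm (residual_sum K L y)"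
    and x: "x \<in> cball xb (\<eta> / 2)"
  shows "infdist x (\<Inter>l\<in>L. K l) \<le> 4 / \<eta> * residual_norm K L x"
proof (rule ccontr)
  assume neg: "\<not> ?thesis"
  let ?f = "residual_norm K L" and ?C = "\<Inter>l\<in>L. K l"
  have ne: "closed (K l) \<and> K l \<noteq> {}" if "l \<in> L" for l using cc xb that by auto
  define g where "g y = ?f y + \<eta> / 4 * norm (y - x)" for y
  \<comment> \<open>Outside of the ball of radius \<open>R\<close> the penalty alone exceeds \<open>g x\<close>.\<close>
  define R where "R = 4 / \<eta> * ?f x"
  have f0: "?f y \<ge> 0" for y by (simp add: residual_norm_def)
  then have "R \<ge> 0" using \<open>\<eta> > 0\<close> by (simp add: R_def)
  have "continuous_on (cball x R) g"
    unfolding g_def by (intro continuous_intros continuous_on_residual_norm ne)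
  then obtain y where y: "y \<in> cball x R" "\<And>z. z \<in> cball x R \<Longrightarrow> g y \<le> g z"
    using continuous_attains_inf[of "cball x R" g] \<open>R \<ge> 0\<close> by auto
  have min: "g y \<le> g z" for z
  proof (cases "z \<in> cball x R")
    case False
    then have "\<eta> / 4 * R \<le> \<eta> / 4 * norm (z - x)"
      using \<open>\<eta> > 0\<close> by (intro mult_left_mono) (auto simp: dist_norm norm_minus_commute)
    then have "g x \<le> g z" using \<open>\<eta> > 0\<close> f0[of z] by (simp add: g_def R_def)
    moreover have "g y \<le> g x" using y(2) \<open>R \<ge> 0\<close> by simp
    ultimately show ?thesis by simp
  qed (rule y(2))
  have yx: "norm (y - x) \<le> R" using y(1) by (simp add: dist_norm norm_minus_commute)
  have "R < infdist x ?C" using neg by (simp add: R_def)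
  have "y \<notin> ?C"
    using infdist_le[of y ?C x] yx \<open>R < infdist x ?C\<close> by (auto simp: dist_norm norm_minus_commute)
  then obtain l where l: "l \<in> L" "y \<notin> K l" by blast
  have "?f y > 0"
  proof -
    have "?f y \<noteq> 0"
      unfolding residual_norm_def L2_set_eq_0_iff[OF \<open>finite L\<close>]
      using l ne[OF l(1)] closest_point_in_set[of "K l" y] by auto
    then show ?thesis using f0[of y] by simp
  qed
  have "infdist x ?C \<le> dist x xb" using xb by (rule infdist_le)
  also have "\<dots> \<le> \<eta> / 2" using x by (simp add: dist_commute)
  finally have "norm (y - x) \<le> \<eta> / 2" using yx \<open>R < infdist x ?C\<close> by simp
  then have "dist xb y \<le> \<eta>"
    using dist_triangle[of xb y x] x by (simp add: dist_norm norm_minus_commute)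
  then have "\<eta> * ?f y \<le> norm (residual_sum K L y)" using lower by simp
  also have "\<dots> \<le> 2 * (\<eta> / 4) * ?f y"
  proof (rule small_residual_sum_at_penalized_minimizer[OF \<open>finite L\<close> ne _ \<open>?f y > 0\<close>])
    fix z
    have "\<eta> / 4 * norm (z - x) \<le> \<eta> / 4 * (norm (z - y) + norm (y - x))"
      using norm_triangle_ineq[of "z - y" "y - x"] \<open>\<eta> > 0\<close> by (intro mult_left_mono) auto
    then show "?f y \<le> ?f z + \<eta> / 4 * norm (z - y)"
      using min[of z] by (simp add: g_def distrib_left)
  qed (use \<open>\<eta> > 0\<close> in auto)
  finally show False using \<open>?f y > 0\<close> \<open>\<eta> > 0\<close> by simp
qed

text \<open>The Euclidean norm of the \<open>r\<close> distances is at most \<open>r\<close> times their maximum.\<close>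

lemma local_metric_ineq_of_normals:
  fixes K :: "nat \<Rightarrow> 'a::euclidean_space set"
  assumes "r > 0" and cc: "\<And>l. l \<in> {1..r} \<Longrightarrow> closed (K l) \<and> convex (K l)"
    and xb: "xb \<in> (\<Inter>l\<in>{1..r}. K l)"
    and normals: "\<And>v. (\<And>l. l \<in> {1..r} \<Longrightarrow> v l \<in> normal_cone (K l) xb) \<Longrightarrow> (\<Sum>l\<in>{1..r}. v l) = 0
          \<Longrightarrow> (\<forall>l\<in>{1..r}. v l = 0)"
  shows "\<exists>\<kappa>. local_metric_ineq r K xb \<kappa>"
proof -
  obtain \<eta> where \<eta>: "\<eta> > 0"
    "\<And>y. y \<in> cball xb \<eta> \<Longrightarrow> \<eta> * residual_norm K {1..r} y \<le> norm (residual_sum K {1..r} y)"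
    using residual_sum_lower_bound[OF _ cc xb normals] by auto
  have "infdist x (\<Inter>l\<in>{1..r}. K l) \<le> 4 * real r / \<eta> * (MAX l\<in>{1..r}. infdist x (K l))"
    if x: "x \<in> cball xb (\<eta> / 2)" for x
  proof -
    have "residual_norm K {1..r} x \<le> (\<Sum>l\<in>{1..r}. norm (x - closest_point (K l) x))"
      unfolding residual_norm_def by (intro L2_set_le_sum) auto
    also have "\<dots> = (\<Sum>l\<in>{1..r}. infdist x (K l))"
      using cc xb by (intro sum.cong refl norm_residual_eq_infdist) auto
    also have "\<dots> \<le> real (card {1..r}) * (MAX l\<in>{1..r}. infdist x (K l))"
      by (intro sum_bounded_above Max_ge) auto
    finally have "4 / \<eta> * residual_norm K {1..r} x
        \<le> 4 / \<eta> * (real r * (MAX l\<in>{1..r}. infdist x (K l)))"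
      using \<eta>(1) by (intro mult_left_mono) auto
    with metric_inequality_of_residual_sum_bound[OF _ _ xb \<eta> x] cc show ?thesis by auto
  qed
  then show ?thesis unfolding local_metric_ineq_def
    using \<eta>(1) \<open>r > 0\<close> by (intro exI[of _ "4 * real r / \<eta>"] conjI exI[of _ "\<eta> / 2"]) auto
qed

section \<open>Convergent runs of the algorithm\<close>

locale convergent_SHQP =
  fixes K :: "nat \<Rightarrow> 'a::euclidean_space set"
    and r p :: nat and x :: "nat \<Rightarrow> 'a" and xb :: 'a
    and S :: "nat \<Rightarrow> (nat \<times> nat) set" and lstar :: "nat \<Rightarrow> nat"
  assumes closed_convex: "\<And>l. l \<in> {1..r} \<Longrightarrow> closed (K l) \<and> convex (K l)"
    and run: "SHQP_run r K p x S lstar"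
    and xb_in: "xb \<in> (\<Inter>l\<in>{1..r}. K l)"
    and lim: "x \<longlonglongrightarrow> xb"
    and not_finite: "\<And>i. x i \<noteq> xb"
begin

lemma lstar_in: "lstar i \<in> {1..r}"
  using run by (simp add: SHQP_run_def)

lemma fejer_monotone:
  assumes "c \<in> (\<Inter>l\<in>{1..r}. K l)" "j \<le> k"
  shows "norm (x k - c) \<le> norm (x j - c)"
proof (rule lift_Suc_antimono_le[of "\<lambda>i. norm (x i - c)"])
  show "norm (x (Suc i) - c) \<le> norm (x i - c)" for i
    using run assms(1) unfolding SHQP_run_def by blast
qed (rule assms(2))

lemma limit_closer:
  assumes "c \<in> (\<Inter>l\<in>{1..r}. K l)"
  shows "norm (xb - c) \<le> norm (x k - c)"
proof (rule LIMSEQ_le_const2)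
  show "(\<lambda>i. norm (x i - c)) \<longlonglongrightarrow> norm (xb - c)" using lim by (intro tendsto_intros)
  show "\<exists>N. \<forall>i\<ge>N. norm (x i - c) \<le> norm (x k - c)" using fejer_monotone[OF assms] by blast
qed

lemma norm_shqp_a:
  assumes "l \<in> {1..r}"
  shows "norm (shqp_a K x i l) = infdist (x i) (K l)"
  unfolding shqp_a_def using assms closed_convex xb_in by (intro norm_residual_eq_infdist) auto

lemma norm_shqp_a_lstar:
  "norm (shqp_a K x i (lstar i)) = (MAX l\<in>{1..r}. infdist (x i) (K l))"
proof -
  have "norm (shqp_a K x i (lstar i)) = (MAX l\<in>{1..r}. norm (x i - closest_point (K l) (x i)))"
    using run unfolding SHQP_run_def shqp_a_def by simp
  also have "(\<lambda>l. norm (x i - closest_point (K l) (x i))) ` {1..r} = (\<lambda>l. infdist (x i) (K l)) ` {1..r}"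
    using norm_shqp_a[of _ i] by (intro image_cong) (simp_all add: shqp_a_def)
  finally show ?thesis .
qed

lemma infdist_inter_asymptotics:
  assumes "\<epsilon> > 0"
  shows "\<forall>\<^sub>F k in sequentially.
    (1 - \<epsilon>) * norm (x k - xb) \<le> infdist (x k) (\<Inter>l\<in>{1..r}. K l)"
  using closed_convex xb_in lim assms not_finite limit_closer
  by (intro asymptotically_at_full_distance) auto

lemma eventually_infdist_le_residual:
  assumes "local_metric_ineq r K xb \<kappa>"
  shows "\<forall>\<^sub>F k in sequentially.
    infdist (x k) (\<Inter>l\<in>{1..r}. K l) \<le> \<kappa> * norm (shqp_a K x k (lstar k))"
proof -
  obtain \<delta> where \<delta>: "\<delta> > 0" "\<forall>y\<in>cball xb \<delta>.
        infdist y (\<Inter>l\<in>{1..r}. K l) \<le> \<kappa> * (MAX l\<in>{1..r}. infdist y (K l))"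
    using assms unfolding local_metric_ineq_def by blast
  have "\<forall>\<^sub>F k in sequentially. dist (x k) xb < \<delta>" using lim \<delta>(1) by (rule tendstoD)
  then show ?thesis
    by eventually_elim (use \<delta>(2) in \<open>auto simp: norm_shqp_a_lstar dist_commute\<close>)
qed

text \<open>The distance to the intersection dominates each single distance, and it does not vanish late in the run.
Hence \<open>1 / \<kappa>\<close> lies in the domain of \<open>arcsin\<close>.\<close>

lemma metric_constant_ge_1:
  assumes "local_metric_ineq r K xb \<kappa>"
  shows "1 \<le> \<kappa>"
proof -
  have "\<kappa> > 0" using assms by (simp add: local_metric_ineq_def)
  have half: "(0::real) < 1 / 2" by simp
  have "\<forall>\<^sub>F k in sequentially. 1 \<le> \<kappa>"
    using eventually_infdist_le_residual[OF assms] infdist_inter_asymptotics[OF half]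
  proof eventually_elim
    case (elim k)
    let ?C = "\<Inter>l\<in>{1..r}. K l"
    have "norm (shqp_a K x k (lstar k)) \<le> infdist (x k) ?C"
      unfolding norm_shqp_a[OF lstar_in] using lstar_in xb_in by (intro infdist_mono) auto
    then have "\<kappa> * norm (shqp_a K x k (lstar k)) \<le> \<kappa> * infdist (x k) ?C"
      using \<open>\<kappa> > 0\<close> by simp
    then have "infdist (x k) ?C \<le> \<kappa> * infdist (x k) ?C" using elim(1) by linarith
    moreover have "0 < (1 - 1 / 2) * norm (x k - xb)" using not_finite by simp
    then have "0 < infdist (x k) ?C" using elim(2) by (rule less_le_trans)
    ultimately show ?case by simp
  qed
  then show ?thesis by simp
qed

text \<open>For all late \<open>k\<close>, every direction that is within \<open>\<alpha>\<close> of the largest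
residual at \<open>x k\<close> makes a uniformly acute angle with the error \<open>x k - xb\<close>;
\<open>c\<close> is a lower bound for its cosine.\<close>

definition aligned :: "real \<Rightarrow> real \<Rightarrow> bool" where
  "aligned c \<alpha> \<longleftrightarrow> (\<forall>\<^sub>F k in sequentially. \<forall>a. vangle a (shqp_a K x k (lstar k)) \<le> \<alpha> \<longrightarrow>
    a \<noteq> 0 \<and> c * norm (x k - xb) \<le> sgn a \<bullet> (x k - xb))"

text \<open>The room between \<open>\<alpha>\<close> and \<open>arcsin (1 / \<kappa>)\<close> is split by some
\<open>\<theta>\<close>. Since \<open>sin \<theta> < 1 / \<kappa>\<close>, the largest residual is, late
in the run, of norm at least \<open>sin \<theta>\<close> times the error, which bounds the angle between
residual and error by \<open>pi / 2 - \<theta>\<close>; the remaining \<open>\<theta> - \<alpha>\<close>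
keeps the angle with the given direction away from \<open>pi / 2\<close>.\<close>

lemma aligned_of_local_metric_ineq:
  assumes "local_metric_ineq r K xb \<kappa>" "\<alpha> < arcsin (1 / \<kappa>)"
  shows "\<exists>c>0. aligned c \<alpha>"
proof -
  have \<kappa>: "1 \<le> \<kappa>" using metric_constant_ge_1[OF assms(1)] .
  have \<kappa>': "0 < 1 / \<kappa>" "1 / \<kappa> \<le> 1" using \<kappa> by auto
  have "0 < arcsin (1 / \<kappa>)" using \<kappa>' arcsin_less_arcsin[of 0 "1 / \<kappa>"] by simp
  \<comment> \<open>For negative \<open>\<alpha>\<close> the angle condition is void; passing to \<open>\<alpha>'\<close> avoids a separate case.\<close>
  define \<alpha>' where "\<alpha>' = max 0 \<alpha>"
  have "\<alpha>' < arcsin (1 / \<kappa>)" using assms(2) \<open>0 < arcsin (1 / \<kappa>)\<close> by (simp add: \<alpha>'_def)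
  then obtain \<theta> where \<theta>: "\<alpha>' < \<theta>" "\<theta> < arcsin (1 / \<kappa>)" using dense by blast
  have "0 \<le> \<alpha>'" "\<alpha> \<le> \<alpha>'" by (auto simp: \<alpha>'_def)
  have le: "arcsin (1 / \<kappa>) \<le> pi / 2" using \<kappa>' by (intro arcsin_ubound) linarith+
  have "sin \<theta> < sin (arcsin (1 / \<kappa>))"
    using \<theta> le \<open>0 \<le> \<alpha>'\<close> by (intro sin_monotone_2pi) auto
  then have sin\<theta>: "0 < 1 - \<kappa> * sin \<theta>" using \<kappa> by (simp add: field_simps)
  have "sin (\<theta> - \<alpha>') > 0" using \<theta> le \<open>0 \<le> \<alpha>'\<close> by (intro sin_gt_zero) auto
  moreover have "aligned (sin (\<theta> - \<alpha>')) \<alpha>"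
    unfolding aligned_def
    using eventually_infdist_le_residual[OF assms(1)]
      infdist_inter_asymptotics[OF sin\<theta>]
  proof eventually_elim
    case (elim k)
    define t where "t = norm (x k - xb)"
    define w where "w = sgn (x k - xb)"
    define b where "b = shqp_a K x k (lstar k)"
    define y where "y = closest_point (K (lstar k)) (x k)"
    have t: "t > 0" and w: "norm w = 1" "x k - xb = t *\<^sub>R w"
      using not_finite by (auto simp: w_def t_def norm_sgn sgn_div_norm)
    have "\<kappa> * (sin \<theta> * t) \<le> \<kappa> * norm b"
      using elim unfolding t_def b_def by (simp add: mult.assoc)
    then have bt: "sin \<theta> * t \<le> norm b" using \<kappa> by simp
    \<comment> \<open>The residual \<open>b\<close> is normal at \<open>y\<close>, so \<open>xb\<close> lies behind the hyperplane that separates \<open>x k\<close> from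
      the set.\<close>
    have "b \<bullet> (xb - y) \<le> 0"
      using closest_point_residual_normal[of "K (lstar k)" "x k"] closed_convex[OF lstar_in]
        lstar_in xb_in by (auto simp: normal_cone_def b_def y_def shqp_a_def)
    moreover have "b \<bullet> (x k - xb) = b \<bullet> b - b \<bullet> (xb - y)"
      by (simp add: b_def y_def shqp_a_def inner_diff_right)
    ultimately have bb: "(norm b)\<^sup>2 \<le> b \<bullet> (t *\<^sub>R w)" unfolding w(2)[symmetric] by (simp add: dot_square_norm)
    show ?case
    proof (intro allI impI)
      fix a assume "vangle a (shqp_a K x k (lstar k)) \<le> \<alpha>"
      then have "vangle a b \<le> \<alpha>'" using \<open>\<alpha> \<le> \<alpha>'\<close> by (simp add: b_def)
      moreover have "\<alpha>' < pi / 2" using \<theta> le by linarith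
      ultimately have a: "a \<noteq> 0" "b \<noteq> 0" "cos \<alpha>' \<le> sgn a \<bullet> sgn b"
        using vangle_le_imp[of a b \<alpha>'] by auto
      have "norm b * (sin \<theta> * t) \<le> norm b * norm b" using bt by (simp add: mult_left_mono)
      also have "\<dots> \<le> b \<bullet> (t *\<^sub>R w)" using bb by (simp add: power2_eq_square)
      also have "\<dots> = norm b * ((sgn b \<bullet> w) * t)" using a(2) by (simp add: sgn_div_norm)
      finally have "sin \<theta> \<le> sgn b \<bullet> w" using a(2) t by simp
      then have "sin (\<theta> - \<alpha>') \<le> sgn a \<bullet> w"
        using a w(1) \<theta> le \<open>0 \<le> \<alpha>'\<close>
        by (intro inner_ge_sin_diff[of "sgn b"]) (auto simp: norm_sgn)
      then show "a \<noteq> 0 \<and> sin (\<theta> - \<alpha>') * norm (x k - xb) \<le> sgn a \<bullet> (x k - xb)"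
        using a(1) t unfolding w(2) by (simp add: w(1))
    qed
  qed
  ultimately show ?thesis by blast
qed

text \<open>The iterate \<open>x (Suc k)\<close> satisfies the halfspace constraint created at \<open>x j\<close>,
whose boundary supports \<open>K l\<close> at the projection of \<open>x j\<close>; by the normal defect
bound it passes close to \<open>xb\<close>.\<close>

lemma cut_bound:
  assumes defect: "\<And>l. l \<in> {1..r} \<Longrightarrow> normal_defect_bound (K l) xb \<rho>"
    and mono: "\<And>s t. 0 \<le> s \<Longrightarrow> s \<le> t \<Longrightarrow> \<rho> s \<le> (\<rho> t :: real)"
  shows "\<forall>\<^sub>F j in sequentially. \<forall>k l. (j, l) \<in> S k \<longrightarrow> shqp_a K x j l \<noteq> 0 \<longrightarrow>
    sgn (shqp_a K x j l) \<bullet> (x (Suc k) - xb) \<le> \<rho> (norm (x j - xb))"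
proof -
  define y where "y l j = closest_point (K l) (x j)" for l j
  have near: "norm (y l j - xb) \<le> norm (x j - xb)" if "l \<in> {1..r}" for l j
    using closest_point_lipschitz[of "K l" "x j" xb] closed_convex[OF that] that xb_in
    by (fastforce simp: y_def dist_norm closest_point_self)
  have "\<forall>\<^sub>F j in sequentially. y l j \<in> K l \<longrightarrow>
      (\<forall>v\<in>normal_cone (K l) (y l j). norm v = 1 \<longrightarrow> v \<bullet> (y l j - xb) \<le> \<rho> (norm (y l j - xb)))"
    if "l \<in> {1..r}" for l
  proof (rule eventually_compose_filterlim[OF defect[OF that, unfolded normal_defect_bound_def]])
    have "(\<lambda>j. y l j - xb) \<longlonglongrightarrow> 0"
    proof (rule Lim_null_comparison)
      show "(\<lambda>j. norm (x j - xb)) \<longlonglongrightarrow> 0" using lim LIM_zero_iff tendsto_norm_zero by blast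
    qed (use near that in simp)
    then show "y l \<longlonglongrightarrow> xb" by (simp add: LIM_zero_iff)
  qed
  then have "\<forall>\<^sub>F j in sequentially. \<forall>l\<in>{1..r}. y l j \<in> K l \<longrightarrow>
      (\<forall>v\<in>normal_cone (K l) (y l j). norm v = 1 \<longrightarrow> v \<bullet> (y l j - xb) \<le> \<rho> (norm (y l j - xb)))"
    by (intro eventually_ball_finite) auto
  then show ?thesis
  proof eventually_elim
    case (elim j)
    show ?case
    proof (intro allI impI)
      fix k l assume jl: "(j, l) \<in> S k" and a: "shqp_a K x j l \<noteq> 0"
      have l: "l \<in> {1..r}" using run jl unfolding SHQP_run_def by blast
      have "x (Suc k) \<in> shqp_halfspace K x j l" using run jl unfolding SHQP_run_def by blast
      then have "shqp_a K x j l \<bullet> x (Suc k) \<le> shqp_a K x j l \<bullet> y l j"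
        by (simp add: shqp_halfspace_def shqp_b_def y_def)
      then have "sgn (shqp_a K x j l) \<bullet> x (Suc k) \<le> sgn (shqp_a K x j l) \<bullet> y l j"
        by (simp add: sgn_div_norm divide_right_mono mult_left_mono)
      then have "sgn (shqp_a K x j l) \<bullet> (x (Suc k) - xb) \<le> sgn (shqp_a K x j l) \<bullet> (y l j - xb)"
        by (simp add: inner_diff_right)
      also have "\<dots> \<le> \<rho> (norm (y l j - xb))"
      proof -
        have "y l j \<in> K l"
          using closed_convex[OF l] l xb_in by (auto simp: y_def intro!: closest_point_in_set)
        moreover have "sgn (shqp_a K x j l) \<in> normal_cone (K l) (y l j)"
          unfolding sgn_div_norm shqp_a_def y_def using closed_convex[OF l]
          by (intro scaleR_mem_normal_cone closest_point_residual_normal) auto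
        ultimately show ?thesis using elim l a by (auto simp: norm_sgn)
      qed
      also have "\<dots> \<le> \<rho> (norm (x j - xb))" using near[OF l] by (intro mono) auto
      finally show "sgn (shqp_a K x j l) \<bullet> (x (Suc k) - xb) \<le> \<rho> (norm (x j - xb))" .
    qed
  qed
qed

text \<open>The scalar product of the error at \<open>k\<close> with the unit normal from step \<open>j\<close> is
bounded below by \<open>aligned\<close> and above by \<open>cut_bound\<close>.\<close>

lemma decrease_bound:
  assumes "aligned c \<alpha>"
    and defect: "\<And>l. l \<in> {1..r} \<Longrightarrow> normal_defect_bound (K l) xb \<rho>"
    and mono: "\<And>s t. 0 \<le> s \<Longrightarrow> s \<le> t \<Longrightarrow> \<rho> s \<le> (\<rho> t :: real)"
  obtains I where "I > 0"
    "\<And>k j l. I < j \<Longrightarrow> I < k \<Longrightarrow> (j, l) \<in> S (k - 1)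
      \<Longrightarrow> vangle (shqp_a K x j l) (shqp_a K x k (lstar k)) \<le> \<alpha>
      \<Longrightarrow> c * norm (x k - xb) \<le> \<rho> (norm (x j - xb))"
proof -
  obtain I1 where I1: "\<And>k a. k \<ge> I1 \<Longrightarrow> vangle a (shqp_a K x k (lstar k)) \<le> \<alpha> \<Longrightarrow>
      a \<noteq> 0 \<and> c * norm (x k - xb) \<le> sgn a \<bullet> (x k - xb)"
    using assms(1) unfolding aligned_def eventually_sequentially by blast
  from cut_bound[of \<rho>, OF defect mono]
  obtain I2 where I2: "\<And>j k l. j \<ge> I2 \<Longrightarrow> (j, l) \<in> S k \<Longrightarrow> shqp_a K x j l \<noteq> 0 \<Longrightarrow>
      sgn (shqp_a K x j l) \<bullet> (x (Suc k) - xb) \<le> \<rho> (norm (x j - xb))"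
    unfolding eventually_sequentially by blast
  show thesis
  proof (rule that[of "Suc (I1 + I2)"])
    fix k j l assume *: "Suc (I1 + I2) < j" "Suc (I1 + I2) < k" "(j, l) \<in> S (k - 1)"
      "vangle (shqp_a K x j l) (shqp_a K x k (lstar k)) \<le> \<alpha>"
    have "shqp_a K x j l \<noteq> 0"
      "c * norm (x k - xb) \<le> sgn (shqp_a K x j l) \<bullet> (x k - xb)"
      using I1[of k "shqp_a K x j l"] * by auto
    moreover have "Suc (k - 1) = k" using * by simp
    ultimately show "c * norm (x k - xb) \<le> \<rho> (norm (x j - xb))"
      using I2[of j l "k - 1"] * by fastforce
  qed simp
qed

lemma ratio_le_ratio:
  assumes "i \<le> j"
  shows "norm (x k - xb) / norm (x i - xb) ^ m \<le> norm (x k - xb) / norm (x j - xb) ^ m"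
  using fejer_monotone[OF xb_in assms] not_finite
  by (intro divide_left_mono power_mono mult_pos_pos zero_less_power) auto

text \<open>The normal defect is always \<open>o(t)\<close>. The constant \<open>c * \<epsilon>\<close> absorbs the
cosine \<open>c\<close>.\<close>

lemma superlinear:
  assumes "local_metric_ineq r K xb \<kappa>" "\<alpha> < arcsin (1 / \<kappa>)" "\<epsilon> > 0"
  shows "\<exists>I>0. \<forall>i k j l.
         I < i \<and> i < k \<and> (j, l) \<in> S (k - 1) \<and> j \<ge> i \<and>
         vangle (shqp_a K x j l) (shqp_a K x k (lstar k)) \<le> \<alpha> \<longrightarrow>
         norm (x k - xb) / norm (x i - xb) \<le> norm (x k - xb) / norm (x j - xb) \<and>
         norm (x k - xb) / norm (x j - xb) \<le> \<epsilon>"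
proof -
  obtain c where c: "c > 0" "aligned c \<alpha>"
    using aligned_of_local_metric_ineq[OF assms(1,2)] by blast
  have defect: "normal_defect_bound (K l) xb (\<lambda>t. c * \<epsilon> * t)" for l
    using c(1) \<open>\<epsilon> > 0\<close> by (intro normal_defect_bound_linear) simp
  have mono: "c * \<epsilon> * s \<le> c * \<epsilon> * t" if "0 \<le> s" "s \<le> t" for s t
    using that c(1) \<open>\<epsilon> > 0\<close> by simp
  from decrease_bound[OF c(2) defect mono]
  obtain I where I: "I > 0" "\<And>k j l. I < j \<Longrightarrow> I < k \<Longrightarrow> (j, l) \<in> S (k - 1) \<Longrightarrow>
            vangle (shqp_a K x j l) (shqp_a K x k (lstar k)) \<le> \<alpha>
          \<Longrightarrow> c * norm (x k - xb) \<le> c * \<epsilon> * norm (x j - xb)"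
    by blast
  show ?thesis
  proof (intro exI[of _ I] conjI allI impI I(1); elim conjE)
    fix i k j l assume *: "I < i" "i < k" "(j, l) \<in> S (k - 1)" "i \<le> j"
      "vangle (shqp_a K x j l) (shqp_a K x k (lstar k)) \<le> \<alpha>"
    show "norm (x k - xb) / norm (x i - xb) \<le> norm (x k - xb) / norm (x j - xb)"
      using ratio_le_ratio[OF *(4), of k 1] by simp
    have "norm (x k - xb) \<le> \<epsilon> * norm (x j - xb)" using I(2)[of j k l] * c(1) by simp
    then show "norm (x k - xb) / norm (x j - xb) \<le> \<epsilon>"
      using not_finite by (simp add: divide_le_eq)
  qed
qed

text \<open>Under SOSH the normal defects are \<open>O(t\<^sup>2)\<close>; the sum of the constants serves all sets
at once.\<close>

lemma quadratic:
  assumes "local_metric_ineq r K xb \<kappa>" "\<alpha> < arcsin (1 / \<kappa>)" "\<forall>l\<in>{1..r}. SOSH (K l) xb"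
  shows "\<exists>M>0. \<exists>I>0. \<forall>i k j l.
         I < i \<and> i < k \<and> (j, l) \<in> S (k - 1) \<and> j \<ge> i \<and>
         vangle (shqp_a K x j l) (shqp_a K x k (lstar k)) \<le> \<alpha> \<longrightarrow>
         norm (x k - xb) / (norm (x i - xb))\<^sup>2 \<le> norm (x k - xb) / (norm (x j - xb))\<^sup>2 \<and>
         norm (x k - xb) / (norm (x j - xb))\<^sup>2 < M"
proof -
  obtain c where c: "c > 0" "aligned c \<alpha>"
    using aligned_of_local_metric_ineq[OF assms(1,2)] by blast
  have "\<forall>l\<in>{1..r}. \<exists>M. normal_defect_bound (K l) xb (\<lambda>t. M * t\<^sup>2)"
    using assms(3) normal_defect_bound_quadratic by fast
  from bchoice[OF this]
  obtain M where M: "\<And>l. l \<in> {1..r} \<Longrightarrow> normal_defect_bound (K l) xb (\<lambda>t. M l * t\<^sup>2)"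
    by blast
  define B where "B = (\<Sum>l\<in>{1..r}. \<bar>M l\<bar>)"
  have "B \<ge> 0" by (simp add: B_def sum_nonneg)
  have defect: "normal_defect_bound (K l) xb (\<lambda>t. B * t\<^sup>2)" if "l \<in> {1..r}" for l
  proof (rule normal_defect_bound_mono[OF M[OF that]])
    have "M l \<le> \<bar>M l\<bar>" by simp
    also have "\<dots> \<le> B" unfolding B_def using that by (intro member_le_sum) auto
    finally show "M l * t\<^sup>2 \<le> B * t\<^sup>2" for t by (simp add: mult_right_mono)
  qed
  have mono: "B * s\<^sup>2 \<le> B * t\<^sup>2" if "0 \<le> s" "s \<le> t" for s t
    using that \<open>B \<ge> 0\<close> by (intro mult_left_mono power_mono)
  from decrease_bound[OF c(2) defect mono]
  obtain I where I: "I > 0" "\<And>k j l. I < j \<Longrightarrow> I < k \<Longrightarrow> (j, l) \<in> S (k - 1) \<Longrightarrow>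
            vangle (shqp_a K x j l) (shqp_a K x k (lstar k)) \<le> \<alpha>
          \<Longrightarrow> c * norm (x k - xb) \<le> B * (norm (x j - xb))\<^sup>2"
    by blast
  show ?thesis
  proof (rule exI[of _ "B / c + 1"], intro exI[of _ I] conjI allI impI I(1); (elim conjE)?)
    show "B / c + 1 > 0" using \<open>B \<ge> 0\<close> c(1) by (simp add: add_nonneg_pos)
  next
    fix i k j l assume *: "I < i" "i < k" "(j, l) \<in> S (k - 1)" "i \<le> j"
      "vangle (shqp_a K x j l) (shqp_a K x k (lstar k)) \<le> \<alpha>"
    show "norm (x k - xb) / (norm (x i - xb))\<^sup>2 \<le> norm (x k - xb) / (norm (x j - xb))\<^sup>2"
      using ratio_le_ratio[OF *(4)] .
    have "norm (x k - xb) \<le> B / c * (norm (x j - xb))\<^sup>2"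
      using I(2)[of j k l] * c(1) by (simp add: field_simps)
    then have "norm (x k - xb) / (norm (x j - xb))\<^sup>2 \<le> B / c"
      using not_finite by (simp add: divide_le_eq)
    then show "norm (x k - xb) / (norm (x j - xb))\<^sup>2 < B / c + 1" by simp
  qed
qed

end

section \<open>The rate of convergence\<close>

theorem theorem3p10:
  fixes K :: "nat \<Rightarrow> (real ^ 'n) set"
    and r p :: nat
    and x :: "nat \<Rightarrow> real ^ 'n"
    and xb :: "real ^ 'n"
    and S :: "nat \<Rightarrow> (nat \<times> nat) set"
    and lstar :: "nat \<Rightarrow> nat"
  assumes closed_convex: "\<And>l. l \<in> {1..r} \<Longrightarrow> closed (K l) \<and> convex (K l)"
    and run: "SHQP_run r K p x S lstar"
    and xb_in: "xb \<in> (\<Inter>l\<in>{1..r}. K l)"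
    and lim: "x \<longlonglongrightarrow> xb"
    and not_finite: "\<And>i. x i \<noteq> xb"
    and normals: "\<And>v :: nat \<Rightarrow> real ^ 'n.
          (\<And>l. l \<in> {1..r} \<Longrightarrow> v l \<in> normal_cone (K l) xb) \<Longrightarrow> (\<Sum>l\<in>{1..r}. v l) = 0
          \<Longrightarrow> (\<forall>l\<in>{1..r}. v l = 0)"
  shows "(\<exists>\<kappa>. local_metric_ineq r K xb \<kappa>) \<and>
    (\<forall>\<kappa> \<alpha>.
      local_metric_ineq r K xb \<kappa> \<longrightarrow> \<alpha> < arcsin (1 / \<kappa>) \<longrightarrow>
      (\<forall>u :: nat \<Rightarrow> real ^ 'n. (\<forall>s<p. norm (u s) = 1) \<longrightarrow>
         (\<exists>s<p. \<exists>t<p. s \<noteq> t \<and> vangle (u s) (u t) \<le> \<alpha>)) \<longrightarrow>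
      (\<forall>\<epsilon>>0. \<exists>I>0. \<forall>i k j l.
         I < i \<and> i < k \<and> (j, l) \<in> S (k - 1) \<and> j \<ge> i \<and>
         vangle (shqp_a K x j l) (shqp_a K x k (lstar k)) \<le> \<alpha> \<longrightarrow>
         norm (x k - xb) / norm (x i - xb) \<le> norm (x k - xb) / norm (x j - xb) \<and>
         norm (x k - xb) / norm (x j - xb) \<le> \<epsilon>) \<and>
      ((\<forall>l\<in>{1..r}. SOSH (K l) xb) \<longrightarrow>
       (\<exists>M>0. \<exists>I>0. \<forall>i k j l.
         I < i \<and> i < k \<and> (j, l) \<in> S (k - 1) \<and> j \<ge> i \<and>
         vangle (shqp_a K x j l) (shqp_a K x k (lstar k)) \<le> \<alpha> \<longrightarrow>
         norm (x k - xb) / (norm (x i - xb))\<^sup>2 \<le> norm (x k - xb) / (norm (x j - xb))\<^sup>2 \<and>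
         norm (x k - xb) / (norm (x j - xb))\<^sup>2 < M)))"
proof -
  interpret convergent_SHQP K r p x xb S lstar
    using closed_convex run xb_in lim not_finite by unfold_locales
  have "r > 0" using lstar_in[of 0] by simp
  then have "\<exists>\<kappa>. local_metric_ineq r K xb \<kappa>"
    using closed_convex xb_in normals by (rule local_metric_ineq_of_normals)
  then show ?thesis
    by (intro conjI allI impI superlinear quadratic)
qed

end
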